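(* Let $W\subset\mathbb{R}^n$ be an open neighbourhood of $0$, let $f,g_1,\dots,g_m$ be smooth vector fields on $W$ and $h_1,\dots,h_p$ smooth functions on $W$ with $h_j(0)=0$ for $j=1,\dots,p$, and consider the control system $\dot x(t)=f(x(t))+\sum_{i=1}^m g_i(x(t))u_i(t)$, $y_\ell(t)=h_\ell(x(t))$, $\ell=1,\dots,p$. Write $H=(h_1,\dots,h_p)^{\mathrm T}$ and let $\mathcal{H}_*$ be the exact co-distribution spanned by $\mathrm{d}h_1,\dots,\mathrm{d}h_p$. Assume that $0$ is a regular point. If $\mathcal{H}_*$ is $f$-invariant and $g_i$-invariant for every $i=1,\dots,m$, then (locally around $0$) there exists an exact OR-system of the control system.
   Context: Regular point: all distributions and co-distributions involved (here $\mathcal{H}_*$) have constant dimension near $0$. The exact co-distribution $\mathcal{H}_*=\mathrm{Span}\{\mathrm{d}h_1,\dots,\mathrm{d}h_p\}$ is $f$-invariant, for a smooth vector field $f$, if there is a smooth matrix-valued function $\Xi$ on $W$ with values in $\mathbb{R}^{p\times p}$ such that $L_f(\mathrm{d}H)=\Xi\,\mathrm{d}H$, where $\mathrm{d}H=(\mathrm{d}h_1,\dots,\mathrm{d}h_p)^{\mathrm T}$ and $L_f$ is the Lie derivative (so $L_f(\mathrm{d}h)=\mathrm{d}(L_fh)$). The output satisfies $\dot y=L_fH(x)+\sum_i L_{g_i}H(x)u_i$. Given a smooth map $\psi$ from (a neighbourhood of $0$ in) $\mathbb{R}^p$ to $W$, the corresponding OR-system (observer-based realization) is $\dot y=L_fH(\psi(y))+\sum_{i=1}^m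 L_{g_i}H(\psi(y))u_i$. It is exact (locally around $0$) if there is a neighbourhood $U\subset W$ of $0$ such that $L_fH(\psi(H(x)))=L_fH(x)$ and $L_{g_i}H(\psi(H(x)))=L_{g_i}H(x)$ for all $x\in U$ and all $i$, i.e. $y=H(x)$ obeys the OR-system along all trajectories of the original system in $U$. *)

theory Defs
  imports "HOL-Analysis.Analysis"
begin

text \<open>For open \<open>S\<close>, this is \<open>k\<close>-fold continuous differentiability; since the domain is
  finite-dimensional, it suffices to iterate derivatives in constant directions.\<close>

primrec Ck_on :: "nat \<Rightarrow> 'a::euclidean_space set \<Rightarrow> ('a \<Rightarrow> 'b::real_normed_vector) \<Rightarrow> bool" where
  "Ck_on 0 S F \<longleftrightarrow> continuous_on S F"
| "Ck_on (Suc k) S F \<longleftrightarrow>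
     (\<forall>x\<in>S. F differentiable (at x)) \<and>
     (\<forall>v. Ck_on k S (\<lambda>x. frechet_derivative F (at x) v))"

definition smooth_on :: "'a::euclidean_space set \<Rightarrow> ('a \<Rightarrow> 'b::real_normed_vector) \<Rightarrow> bool" where
  "smooth_on S F \<longleftrightarrow> (\<forall>k. Ck_on k S F)"

text \<open>Covectors on \<open>real^'n\<close> are written as row vectors, also of type \<open>real^'n\<close>.\<close>

definition diff_form :: "(real^'n \<Rightarrow> real) \<Rightarrow> real^'n \<Rightarrow> real^'n" where
  "diff_form h x = (\<chi> k. frechet_derivative h (at x) (axis k 1))"

definition lie_fun :: "(real^'n \<Rightarrow> real^'n) \<Rightarrow> (real^'n \<Rightarrow> real) \<Rightarrow> real^'n \<Rightarrow> real" where
  "lie_fun X h x = frechet_derivative h (at x) (X x)"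

text \<open>The Lie derivative of a covector field \<open>\<omega>\<close>; in coordinates
  $(L_X\omega)_k = \sum_j X_j\,\partial_j\omega_k + \sum_j \omega_j\,\partial_k X_j$.\<close>

definition lie_form :: "(real^'n \<Rightarrow> real^'n) \<Rightarrow> (real^'n \<Rightarrow> real^'n) \<Rightarrow> real^'n \<Rightarrow> real^'n" where
  "lie_form X \<omega> x = frechet_derivative \<omega> (at x) (X x) + \<omega> x v* jacobian X (at x)"

definition output_map :: "('p \<Rightarrow> real^'n \<Rightarrow> real) \<Rightarrow> real^'n \<Rightarrow> real^'p" where
  "output_map h x = (\<chi> j. h j x)"

definition lie_output :: "(real^'n \<Rightarrow> real^'n) \<Rightarrow> ('p \<Rightarrow> real^'n \<Rightarrow> real) \<Rightarrow> real^'n \<Rightarrow> real^'p" where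
  "lie_output X h x = (\<chi> j. lie_fun X (h j) x)"

definition exact_codist :: "('p \<Rightarrow> real^'n \<Rightarrow> real) \<Rightarrow> real^'n \<Rightarrow> (real^'n) set" where
  "exact_codist h x = span (range (\<lambda>j. diff_form (h j) x))"

definition regular_point :: "(real^'n \<Rightarrow> (real^'n) set) \<Rightarrow> real^'n \<Rightarrow> bool" where
  "regular_point \<Delta> a \<longleftrightarrow> (\<exists>r. \<forall>\<^sub>F x in nhds a. dim (\<Delta> x) = r)"

text \<open>Invariance of \<open>exact_codist h\<close> under \<open>X\<close>. The rows of the two \<open>real^'n^'p\<close> matrices are
  the covectors \<open>L\<^sub>X (dh\<^sub>j)\<close> and \<open>dh\<^sub>j\<close>.\<close>

definition codist_invariant ::
    "(real^'n) set \<Rightarrow> (real^'n \<Rightarrow> real^'n) \<Rightarrow> ('p::finite \<Rightarrow> real^'n \<Rightarrow> real) \<Rightarrow> bool" where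
  "codist_invariant W X h \<longleftrightarrow>
     (\<exists>\<Xi> :: real^'n \<Rightarrow> real^'p^'p. smooth_on W \<Xi> \<and>
        (\<forall>x\<in>W. (\<chi> j. lie_form X (diff_form (h j)) x) = \<Xi> x ** (\<chi> j. diff_form (h j) x)))"

text \<open>The OR-system given by \<open>\<psi>\<close> is
  $\dot y = \mathit{or\_field}\,f\,h\,\psi\,y + \sum_i u_i\,\mathit{or\_field}\,g_i\,h\,\psi\,y$.\<close>

definition or_field ::
    "(real^'n \<Rightarrow> real^'n) \<Rightarrow> ('p \<Rightarrow> real^'n \<Rightarrow> real) \<Rightarrow> (real^'p \<Rightarrow> real^'n) \<Rightarrow> real^'p \<Rightarrow> real^'p" where
  "or_field X h \<psi> y = lie_output X h (\<psi> y)"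

text \<open>Here \<open>\<psi>\<close> is only meaningful on \<open>V\<close>, so \<open>U\<close> must be mapped into \<open>V\<close> by the output.\<close>

definition exact_or_system ::
    "(real^'n) set \<Rightarrow> (real^'n \<Rightarrow> real^'n) \<Rightarrow> nat \<Rightarrow> (nat \<Rightarrow> real^'n \<Rightarrow> real^'n) \<Rightarrow>
     ('p::finite \<Rightarrow> real^'n \<Rightarrow> real) \<Rightarrow> (real^'p) set \<Rightarrow> (real^'p \<Rightarrow> real^'n) \<Rightarrow> bool" where
  "exact_or_system W f m g h V \<psi> \<longleftrightarrow>
     open V \<and> 0 \<in> V \<and> smooth_on V \<psi> \<and> \<psi> ` V \<subseteq> W \<and>
     (\<exists>U. open U \<and> 0 \<in> U \<and> U \<subseteq> W \<and> output_map h ` U \<subseteq> V \<and>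
        (\<forall>x\<in>U. or_field f h \<psi> (output_map h x) = lie_output f h x \<and>
               (\<forall>i\<in>{1..m}. or_field (g i) h \<psi> (output_map h x) = lie_output (g i) h x)))"

end

theory Submission
  imports Defs
begin

text \<open>Let \<open>S\<close> be the span of the \<open>dh\<^sub>j(0)\<close> and \<open>Q\<close> the orthogonal projection onto \<open>S\<close>. The map
  \<open>\<Phi>(x) = \<Sum>\<^sub>j h\<^sub>j(x) dh\<^sub>j(0) + (x - Q x)\<close> is a local diffeomorphism at \<open>0\<close>, with inverse \<open>\<Psi>\<close>, and
  \<open>Q \<Phi>(x) = \<Sum>\<^sub>j h\<^sub>j(x) dh\<^sub>j(0)\<close> depends on \<open>x\<close> only through \<open>H(x)\<close>. Since the rank of \<open>dH\<close> is constant,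
  the fibres of \<open>Q \<Phi>\<close> are tangent to the kernel of \<open>dH\<close>. By invariance \<open>d(L\<^sub>X h\<^sub>j) = L\<^sub>X(dh\<^sub>j)\<close> vanishes
  on this kernel, so \<open>L\<^sub>X h\<^sub>j\<close> is constant along the fibres and takes the same value at \<open>x\<close> as at
  \<open>\<Psi>(Q \<Phi>(x))\<close>. Hence \<open>\<psi>(y) = \<Psi>(\<Sum>\<^sub>j y\<^sub>j dh\<^sub>j(0))\<close> gives an exact OR-system.\<close>

section \<open>Calculus of \<open>Ck_on\<close> maps: congruence, sums, products, reciprocals,
  composition\<close>

lemma Ck_on_cong:
  assumes "open S" "\<And>x. x \<in> S \<Longrightarrow> F x = G x" "Ck_on k S F"
  shows "Ck_on k S G"
  using assms(2,3)
proof (induction k arbitrary: F G)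
  case 0
  then show ?case by (simp cong: continuous_on_cong)
next
  case (Suc k)
  have der: "(G has_derivative frechet_derivative F (at x)) (at x)" if "x \<in> S" for x
    using has_derivative_transform_within_open[of F _ x UNIV, OF _ \<open>open S\<close> that] Suc.prems that
    by (simp add: frechet_derivative_works)
  then have "frechet_derivative F (at x) = frechet_derivative G (at x)" if "x \<in> S" for x
    using frechet_derivative_at that by blast
  then have "Ck_on k S (\<lambda>x. frechet_derivative G (at x) v)" for v
    using Suc.IH[of "\<lambda>x. frechet_derivative F (at x) v" "\<lambda>x. frechet_derivative G (at x) v"] Suc.prems(2)
    by simp
  moreover have "\<forall>x\<in>S. G differentiable (at x)"
    using der differentiableI by blast
  ultimately show ?case by simp
qed

text \<open>By uniqueness of derivatives an explicit formula \<open>F'\<close> may replace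
  \<open>frechet_derivative\<close>. The closure proofs below raise the order through this
  rule.\<close>

lemma Ck_on_SucI:
  assumes "open S" "\<And>x. x \<in> S \<Longrightarrow> (F has_derivative F' x) (at x)"
    and "\<And>v. Ck_on k S (\<lambda>x. F' x v)"
  shows "Ck_on (Suc k) S F"
proof -
  have "F' x = frechet_derivative F (at x)" if "x \<in> S" for x
    using assms(2) frechet_derivative_at that by blast
  then have "Ck_on k S (\<lambda>x. frechet_derivative F (at x) v)" for v
    using Ck_on_cong[OF assms(1) _ assms(3)[of v], of "\<lambda>x. frechet_derivative F (at x) v"] by simp
  then show ?thesis using assms(2) by (auto simp: differentiable_def)
qed

lemma Ck_on_has_derivative:
  "Ck_on (Suc k) S F \<Longrightarrow> x \<in> S \<Longrightarrow> (F has_derivative frechet_derivative F (at x)) (at x)"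
  by (simp add: frechet_derivative_works)

lemma Ck_on_deriv: "Ck_on (Suc k) S F \<Longrightarrow> Ck_on k S (\<lambda>x. frechet_derivative F (at x) v)"
  by simp

lemma Ck_on_Suc_imp: "Ck_on (Suc k) S F \<Longrightarrow> Ck_on k S F"
proof (induction k arbitrary: F)
  case 0
  then show ?case
    by (auto intro!: continuous_at_imp_continuous_on differentiable_imp_continuous_within)
next
  case (Suc k)
  then show ?case by (subst Ck_on.simps(2)) (auto simp del: Ck_on.simps simp: Ck_on.simps(2)[of "Suc k"])
qed

lemma Ck_on_subset: "Ck_on k S F \<Longrightarrow> T \<subseteq> S \<Longrightarrow> Ck_on k T F"
  by (induction k arbitrary: F) (auto intro: continuous_on_subset)

lemma Ck_on_const: "Ck_on k S (\<lambda>x. c)"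
  by (induction k arbitrary: c) auto

lemma Ck_on_bounded_linear:
  assumes "open S" "bounded_linear L" "Ck_on k S F"
  shows "Ck_on k S (\<lambda>x. L (F x))"
  using assms(3)
proof (induction k arbitrary: F)
  case 0
  then show ?case using bounded_linear.continuous_on[OF assms(2)] by simp
next
  case (Suc k)
  then show ?case
    using bounded_linear.has_derivative[OF assms(2) Ck_on_has_derivative[OF Suc.prems]]
    by (intro Ck_on_SucI[OF assms(1), where F' = "\<lambda>x v. L (frechet_derivative F (at x) v)"]) auto
qed

lemma Ck_on_ident: "open S \<Longrightarrow> Ck_on k S (\<lambda>x. x)"
  by (cases k) (auto intro!: Ck_on_SucI Ck_on_const)

lemma Ck_on_add:
  assumes "open S" "Ck_on k S F" "Ck_on k S G"
  shows "Ck_on k S (\<lambda>x. F x + G x)"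
  using assms(2,3)
proof (induction k arbitrary: F G)
  case 0
  then show ?case by (simp add: continuous_on_add)
next
  case (Suc k)
  then show ?case
    using has_derivative_add[OF Ck_on_has_derivative[OF Suc.prems(1)] Ck_on_has_derivative[OF Suc.prems(2)]]
    by (intro Ck_on_SucI[OF assms(1), where F' = "\<lambda>x v. frechet_derivative F (at x) v + frechet_derivative G (at x) v"]) auto
qed

lemma Ck_on_sum:
  assumes "open S" "\<And>i. i \<in> I \<Longrightarrow> Ck_on k S (F i)"
  shows "Ck_on k S (\<lambda>x. \<Sum>i\<in>I. F i x)"
  using assms(2)
  by (induction I rule: infinite_finite_induct) (auto intro: Ck_on_add[OF assms(1)] Ck_on_const)

text \<open>Leibniz rule: each summand of the derivative pairs one undifferentiated map with one
  derivative, both of order \<open>k\<close>, so the induction hypothesis has to be general in both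
  arguments.\<close>

lemma Ck_on_bilinear:
  assumes "open S" "bounded_bilinear B" "Ck_on k S F" "Ck_on k S G"
  shows "Ck_on k S (\<lambda>x. B (F x) (G x))"
  using assms(3,4)
proof (induction k arbitrary: F G)
  case 0
  then show ?case by (simp add: bounded_bilinear.continuous_on[OF assms(2)])
next
  case (Suc k)
  note low = Suc.prems[THEN Ck_on_Suc_imp]
  have "Ck_on k S (\<lambda>x. B (F x) (frechet_derivative G (at x) v) + B (frechet_derivative F (at x) v) (G x))" for v
    using Suc.prems low by (intro Ck_on_add[OF assms(1)] Suc.IH) auto
  then show ?case
    using bounded_bilinear.FDERIV[OF assms(2) Ck_on_has_derivative[OF Suc.prems(1)] Ck_on_has_derivative[OF Suc.prems(2)]]
    by (intro Ck_on_SucI[OF assms(1), where F' = "\<lambda>x v. B (F x) (frechet_derivative G (at x) v) + B (frechet_derivative F (at x) v) (G x)"]) auto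
qed

lemmas Ck_on_mult = Ck_on_bilinear[OF _ bounded_bilinear_mult]
  and Ck_on_scaleR = Ck_on_bilinear[OF _ bounded_bilinear_scaleR]

lemma Ck_on_prod:
  fixes F :: "'i \<Rightarrow> 'a::euclidean_space \<Rightarrow> real"
  assumes "open S" "\<And>i. i \<in> I \<Longrightarrow> Ck_on k S (F i)"
  shows "Ck_on k S (\<lambda>x. \<Prod>i\<in>I. F i x)"
  using assms(2)
  by (induction I rule: infinite_finite_induct) (auto intro: Ck_on_mult[OF assms(1)] Ck_on_const)

text \<open>The derivative of the reciprocal contains only the reciprocal itself and the derivative
  of \<open>F\<close>; both have order \<open>k\<close> by induction.\<close>

lemma Ck_on_inverse:
  fixes F :: "'a::euclidean_space \<Rightarrow> real"
  assumes "open S" "Ck_on k S F" "\<And>x. x \<in> S \<Longrightarrow> F x \<noteq> 0"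
  shows "Ck_on k S (\<lambda>x. inverse (F x))"
  using assms(2)
proof (induction k)
  case 0
  then show ?case by (simp add: assms(3) continuous_on_inverse)
next
  case (Suc k)
  have "Ck_on k S (\<lambda>x. - 1 * (inverse (F x) * frechet_derivative F (at x) v * inverse (F x)))" for v
    using Suc.IH[OF Ck_on_Suc_imp[OF Suc.prems]] Suc.prems
    by (intro Ck_on_mult Ck_on_const assms(1)) auto
  then show ?case
    using Deriv.has_derivative_inverse[OF assms(3) Ck_on_has_derivative[OF Suc.prems]]
    by (intro Ck_on_SucI[OF assms(1), where F' = "\<lambda>x v. - (inverse (F x) * frechet_derivative F (at x) v * inverse (F x))"]) auto
qed

text \<open>In the chain rule the outer derivative is taken in the direction \<open>F'(x) v\<close>,
  which moves with \<open>x\<close>, while \<open>Ck_on\<close> speaks of constant directions only.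
  Expanding this direction in the basis leaves derivatives of \<open>G\<close> in constant
  directions with scalar coefficients.\<close>

lemma Ck_on_compose:
  fixes F :: "'a::euclidean_space \<Rightarrow> 'b::euclidean_space"
  assumes "open S" "open T" "F ` S \<subseteq> T" "Ck_on k T G" "Ck_on k S F"
  shows "Ck_on k S (\<lambda>x. G (F x))"
  using assms(4,5)
proof (induction k arbitrary: G)
  case 0
  then show ?case using assms(3) by (auto intro: continuous_on_compose2)
next
  case (Suc k)
  let ?F' = "\<lambda>x. frechet_derivative F (at x)"
  let ?G' = "\<lambda>x. frechet_derivative G (at x)"
  have "((\<lambda>x. G (F x)) has_derivative (\<lambda>v. \<Sum>b\<in>Basis. (?F' x v \<bullet> b) *\<^sub>R ?G' (F x) b)) (at x)"
    if "x \<in> S" for x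
  proof -
    have dF: "(F has_derivative ?F' x) (at x)" and dG: "(G has_derivative ?G' (F x)) (at (F x))"
      using Ck_on_has_derivative Suc.prems that assms(3) by blast+
    have "?G' (F x) w = (\<Sum>b\<in>Basis. (w \<bullet> b) *\<^sub>R ?G' (F x) b)" for w
      by (subst euclidean_representation[symmetric, of w])
        (simp only: linear_sum[OF has_derivative_linear[OF dG]] linear_cmul[OF has_derivative_linear[OF dG]])
    then have "(\<lambda>v. ?G' (F x) (?F' x v)) = (\<lambda>v. \<Sum>b\<in>Basis. (?F' x v \<bullet> b) *\<^sub>R ?G' (F x) b)"
      by (intro ext)
    then show ?thesis
      using has_derivative_compose[OF dF dG] by metis
  qed
  moreover have "Ck_on k S (\<lambda>x. \<Sum>b\<in>Basis. (?F' x v \<bullet> b) *\<^sub>R ?G' (F x) b)" for v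
  proof (intro Ck_on_sum Ck_on_scaleR assms(1))
    fix b :: 'b
    show "Ck_on k S (\<lambda>x. ?F' x v \<bullet> b)"
      by (intro Ck_on_bounded_linear[OF assms(1) bounded_linear_inner_left] Ck_on_deriv Suc.prems)
    show "Ck_on k S (\<lambda>x. ?G' (F x) b)"
      by (rule Suc.IH[OF Ck_on_deriv[OF Suc.prems(1)] Ck_on_Suc_imp[OF Suc.prems(2)]])
  qed
  ultimately show ?case by (rule Ck_on_SucI[OF assms(1)])
qed

section \<open>Vectors, determinants and smoothness of inverse maps\<close>

lemma vec_lambda_eq_sum_axis: "(\<chi> i. x i) = (\<Sum>i\<in>UNIV. x i *\<^sub>R axis i (1::real))"
  by (simp add: vec_eq_iff axis_def if_distrib cong: if_cong)

lemma Ck_on_vec_lambda: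
  fixes F :: "'i::finite \<Rightarrow> 'a::euclidean_space \<Rightarrow> real"
  assumes "open S" "\<And>i. Ck_on k S (F i)"
  shows "Ck_on k S (\<lambda>x. \<chi> i. F i x)"
  using assms by (simp add: vec_lambda_eq_sum_axis Ck_on_sum Ck_on_scaleR Ck_on_const)

lemma Ck_on_det:
  fixes A :: "'a::euclidean_space \<Rightarrow> real^'n^'n"
  assumes "open S" "\<And>i j. Ck_on k S (\<lambda>x. A x $ i $ j)"
  shows "Ck_on k S (\<lambda>x. det (A x))"
  unfolding det_def using assms by (intro Ck_on_sum Ck_on_mult Ck_on_prod Ck_on_const)

text \<open>Cramer's rule expresses the derivative of the inverse through that of \<open>F\<close> along \<open>G\<close>, so
  that the order of differentiability of \<open>G\<close> can be raised step by step.\<close>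

lemma smooth_on_inverse:
  fixes F G :: "real^'n \<Rightarrow> real^'n"
  assumes "open S" "open T" "G ` T \<subseteq> S" "smooth_on S F"
    and G': "\<And>y. y \<in> T \<Longrightarrow> (G has_derivative G' y) (at y)"
    and FG: "\<And>y v. y \<in> T \<Longrightarrow> frechet_derivative F (at (G y)) (G' y v) = v"
  shows "smooth_on T G"
proof -
  define A where "A y = matrix (frechet_derivative F (at (G y)))" for y
  have lin: "linear (frechet_derivative F (at (G y)))" if "y \<in> T" for y
    using assms(3,4) that linear_frechet_derivative[of F]
    unfolding smooth_on_def by (metis Ck_on.simps(2) image_subset_iff)
  have AG': "A y *v G' y v = v" if "y \<in> T" for y v
    unfolding A_def using matrix_vector_mul(2)[OF lin[OF that]] FG[OF that]
    by (metis)
  \<comment> \<open>Every \<open>v\<close> is attained by \<open>A y\<close>, so this square matrix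
    is onto and hence invertible.\<close>
  have det0: "det (A y) \<noteq> 0" if "y \<in> T" for y
    using AG'[OF that] invertible_det_nz invertible_right_inverse matrix_right_invertible_surjective
    by (metis surjI)
  have "Ck_on k T G" for k
  proof (induction k)
    case 0
    then show ?case
      using G' by (auto intro: continuous_at_imp_continuous_on has_derivative_continuous)
  next
    case (Suc k)
    \<comment> \<open>The entries are partial derivatives of the smooth \<open>F\<close>, evaluated
      along \<open>G\<close>, which has order \<open>k\<close> by induction.\<close>
    have entry: "Ck_on k T (\<lambda>y. A y $ i $ j)" for i j
    proof -
      have "Ck_on k S (\<lambda>x. frechet_derivative F (at x) (axis j 1))"
        by (rule Ck_on_deriv) (use assms(4) in \<open>simp only: smooth_on_def\<close>)
      from Ck_on_compose[OF assms(2,1,3) this Suc]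
      show ?thesis
        by (simp add: A_def matrix_def Ck_on_bounded_linear[OF assms(2) bounded_linear_vec_nth])
    qed
    show ?case
    proof (rule Ck_on_SucI[OF assms(2)])
      fix y assume y: "y \<in> T"
      have "G' y = (\<lambda>v. \<chi> l. det (\<chi> i j. if j = l then v $ i else A y $ i $ j) * inverse (det (A y)))"
        using cramer[OF det0[OF y], of "G' y v" v for v] AG'[OF y]
        by (auto simp: divide_inverse)
      then show "(G has_derivative (\<lambda>v. \<chi> l. det (\<chi> i j. if j = l then v $ i else A y $ i $ j) * inverse (det (A y)))) (at y)"
        using G'[OF y] by simp
    next
      fix v
      have "Ck_on k T (\<lambda>y. (\<chi> i j. if j = l then v $ i else A y $ i $ j) $ i $ j)" for i j l
        using entry Ck_on_const by (cases "j = l") auto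
      then show "Ck_on k T (\<lambda>y. \<chi> l. det (\<chi> i j. if j = l then v $ i else A y $ i $ j) * inverse (det (A y)))"
        by (intro Ck_on_vec_lambda Ck_on_mult Ck_on_inverse Ck_on_det assms(2) entry det0)
    qed
  qed
  then show ?thesis by (simp add: smooth_on_def)
qed

section \<open>Symmetry of second derivatives\<close>

text \<open>Two uses of the mean value theorem: first in direction \<open>u\<close> for the
  difference of \<open>F\<close> along two opposite sides of the parallelogram, then in direction
  \<open>v\<close> for the derivative along \<open>u\<close>.\<close>

lemma second_difference_mean_value:
  fixes F :: "'a::euclidean_space \<Rightarrow> real"
  assumes "Ck_on 2 S F" "0 < t"
    and S: "\<And>a b. a \<in> {0..t} \<Longrightarrow> b \<in> {0..t} \<Longrightarrow> x + a *\<^sub>R u + b *\<^sub>R v \<in> S"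
  obtains a b where "a \<in> {0..t}" "b \<in> {0..t}"
    "F (x + t *\<^sub>R u + t *\<^sub>R v) - F (x + t *\<^sub>R u) - F (x + t *\<^sub>R v) + F x =
     t * t * frechet_derivative (\<lambda>y. frechet_derivative F (at y) u) (at (x + a *\<^sub>R u + b *\<^sub>R v)) v"
proof -
  let ?D = "\<lambda>y. frechet_derivative F (at y) u"
  have C2: "Ck_on (Suc (Suc 0)) S F" using assms(1) by (simp add: numeral_2_eq_2)
  have line: "((\<lambda>s. G (p + s *\<^sub>R w)) has_real_derivative frechet_derivative G (at (p + s *\<^sub>R w)) w) (at s)"
    if "Ck_on (Suc k) S G" "p + s *\<^sub>R w \<in> S" for G :: "'a \<Rightarrow> real" and p w s k
  proof -
    note dG = Ck_on_has_derivative[OF that]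
    have "((\<lambda>s. p + s *\<^sub>R w) has_derivative (\<lambda>s. s *\<^sub>R w)) (at s)"
      by (auto intro!: derivative_eq_intros)
    from has_derivative_compose[OF this dG]
    show ?thesis
      by (simp add: has_field_derivative_def linear_cmul[OF has_derivative_linear[OF dG]] mult.commute[of _ "frechet_derivative G _ w"])
  qed
  have "((\<lambda>s. F ((x + t *\<^sub>R v) + s *\<^sub>R u) - F (x + s *\<^sub>R u)) has_real_derivative
      ?D ((x + t *\<^sub>R v) + a *\<^sub>R u) - ?D (x + a *\<^sub>R u)) (at a)" if "0 \<le> a" "a \<le> t" for a
    using S[of a t] S[of a 0] that \<open>0 < t\<close>
    by (intro DERIV_diff line[OF C2]) (auto simp: algebra_simps)
  from MVT2[OF \<open>0 < t\<close> this] obtain a where a: "0 < a" "a < t"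
    and eq1: "F ((x + t *\<^sub>R v) + t *\<^sub>R u) - F (x + t *\<^sub>R u) - (F ((x + t *\<^sub>R v) + 0 *\<^sub>R u) - F (x + 0 *\<^sub>R u))
      = (t - 0) * (?D ((x + t *\<^sub>R v) + a *\<^sub>R u) - ?D (x + a *\<^sub>R u))"
    by blast
  have "((\<lambda>s. ?D ((x + a *\<^sub>R u) + s *\<^sub>R v)) has_real_derivative
      frechet_derivative ?D (at ((x + a *\<^sub>R u) + b *\<^sub>R v)) v) (at b)" if "0 \<le> b" "b \<le> t" for b
    using S[of a b] a that by (intro line[OF Ck_on_deriv[OF C2]]) auto
  from MVT2[OF \<open>0 < t\<close> this] obtain b where b: "0 < b" "b < t"
    and eq2: "?D ((x + a *\<^sub>R u) + t *\<^sub>R v) - ?D ((x + a *\<^sub>R u) + 0 *\<^sub>R v)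
      = (t - 0) * frechet_derivative ?D (at ((x + a *\<^sub>R u) + b *\<^sub>R v)) v"
    by blast
  show thesis
    using that[of a b] a b eq1 eq2 by (simp add: algebra_simps)
qed

text \<open>The second difference does not change when \<open>u\<close> and \<open>v\<close> are
  swapped, so the two mixed derivatives share a value at suitable points arbitrarily close to
  \<open>x\<close>. Continuity of both then forces equality at \<open>x\<close>.\<close>

lemma frechet_derivative_symmetric:
  fixes F :: "'a::euclidean_space \<Rightarrow> real"
  assumes "open S" "x \<in> S" "Ck_on 2 S F"
  shows "frechet_derivative (\<lambda>y. frechet_derivative F (at y) u) (at x) v =
         frechet_derivative (\<lambda>y. frechet_derivative F (at y) v) (at x) u"
proof (rule ccontr)
  let ?D = "\<lambda>u v y. frechet_derivative (\<lambda>y. frechet_derivative F (at y) u) (at y) v"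
  assume neq: "?D u v x \<noteq> ?D v u x"
  \<comment> \<open>Half the supposed gap: the open intervals of radius \<open>e\<close> around the
    two values are disjoint.\<close>
  define e where "e = \<bar>?D u v x - ?D v u x\<bar> / 2"
  have "0 < e" using neq by (simp add: e_def)
  have C0: "Ck_on 0 S (?D u v)" for u v
    using assms(3) by (simp add: numeral_2_eq_2)
  have "isCont (?D u v) x" for u v
    using C0[of u v] continuous_on_eq_continuous_at[OF assms(1), of "?D u v"] assms(2) by simp
  then have "(?D u v \<longlongrightarrow> ?D u v x) (nhds x)" for u v
    using tendsto_at_iff_tendsto_nhds[of "?D u v" x] by (simp add: isCont_def)
  then have "\<forall>\<^sub>F y in nhds x. dist (?D u v y) (?D u v x) < e" for u v
    using \<open>0 < e\<close> by (rule tendstoD)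
  then have "\<forall>\<^sub>F y in nhds x. y \<in> S \<and> dist (?D u v y) (?D u v x) < e \<and> dist (?D v u y) (?D v u x) < e"
    using eventually_nhds_in_open[OF assms(1,2)] by (intro eventually_conj) auto
  then obtain d where "0 < d" and d: "\<And>y. dist y x < d \<Longrightarrow>
      y \<in> S \<and> dist (?D u v y) (?D u v x) < e \<and> dist (?D v u y) (?D v u x) < e"
    by (auto simp: eventually_nhds_metric)
  \<comment> \<open>Keeps the whole parallelogram within distance \<open>d / 2\<close> of
    \<open>x\<close>; the summand 1 makes the denominator positive for all \<open>u\<close> and
    \<open>v\<close>.\<close>
  define t where "t = d / (2 * (norm u + norm v + 1))"
  have pos: "0 < norm u + norm v + 1" by (simp add: add_nonneg_pos)
  have "0 < t" using \<open>0 < d\<close> pos by (simp add: t_def)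
  have near: "dist (x + a *\<^sub>R u + b *\<^sub>R v) x < d" if "a \<in> {0..t}" "b \<in> {0..t}" for a b
  proof -
    have "norm (a *\<^sub>R u + b *\<^sub>R v) \<le> \<bar>a\<bar> * norm u + \<bar>b\<bar> * norm v"
      using norm_triangle_ineq[of "a *\<^sub>R u" "b *\<^sub>R v"] by simp
    also have "\<dots> \<le> t * norm u + t * norm v"
      using that by (intro add_mono mult_right_mono) auto
    also have "\<dots> \<le> t * (norm u + norm v + 1)" using \<open>0 < t\<close> by (simp add: algebra_simps)
    also have "\<dots> = d / 2" using pos by (simp add: t_def field_simps)
    finally show ?thesis using \<open>0 < d\<close> by (simp add: dist_norm add.assoc)
  qed
  obtain a b where ab: "a \<in> {0..t}" "b \<in> {0..t}" and
    1: "F (x + t *\<^sub>R u + t *\<^sub>R v) - F (x + t *\<^sub>R u) - F (x + t *\<^sub>R v) + F x = t * t * ?D u v (x + a *\<^sub>R u + b *\<^sub>R v)"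
    using second_difference_mean_value[OF assms(3) \<open>0 < t\<close>, of x u v] near d by blast
  have near': "dist (x + b *\<^sub>R v + a *\<^sub>R u) x < d" if "a \<in> {0..t}" "b \<in> {0..t}" for a b
    using near[OF that] by (simp add: add_ac)
  then have inS': "x + b *\<^sub>R v + a *\<^sub>R u \<in> S" if "b \<in> {0..t}" "a \<in> {0..t}" for a b
    using d that by blast
  obtain a' b' where ab': "a' \<in> {0..t}" "b' \<in> {0..t}" and
    2: "F (x + t *\<^sub>R v + t *\<^sub>R u) - F (x + t *\<^sub>R v) - F (x + t *\<^sub>R u) + F x = t * t * ?D v u (x + b' *\<^sub>R v + a' *\<^sub>R u)"
    using second_difference_mean_value[OF assms(3) \<open>0 < t\<close> inS'] by blast
  have "t * t * ?D u v (x + a *\<^sub>R u + b *\<^sub>R v) = t * t * ?D v u (x + b' *\<^sub>R v + a' *\<^sub>R u)"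
    using 1 2 by (simp add: algebra_simps)
  then have "?D u v (x + a *\<^sub>R u + b *\<^sub>R v) = ?D v u (x + b' *\<^sub>R v + a' *\<^sub>R u)"
    using \<open>0 < t\<close> by simp
  moreover have "dist (?D u v (x + a *\<^sub>R u + b *\<^sub>R v)) (?D u v x) < e"
    "dist (?D v u (x + b' *\<^sub>R v + a' *\<^sub>R u)) (?D v u x) < e"
    using d[OF near[OF ab]] d[OF near'[OF ab']] by blast+
  moreover have False if "p = q" "dist p a < \<bar>a - b\<bar> / 2" "dist q b < \<bar>a - b\<bar> / 2" for p q a b :: real
    using that by (auto simp: dist_real_def abs_if split: if_splits)
  ultimately show False
    unfolding e_def by blast
qed

section \<open>Lie derivatives of functions and of their differentials\<close>

lemma diff_form_inner:
  assumes "h differentiable (at x)"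
  shows "diff_form h x \<bullet> v = frechet_derivative h (at x) v"
proof -
  note lin = linear_frechet_derivative[OF assms]
  have "frechet_derivative h (at x) v = frechet_derivative h (at x) (\<Sum>k\<in>UNIV. v $ k *\<^sub>R axis k 1)"
    using basis_expansion[of v] by (simp add: scalar_mult_eq_scaleR)
  also have "\<dots> = diff_form h x \<bullet> v"
    by (simp add: linear_sum[OF lin] linear_cmul[OF lin] diff_form_def inner_vec_def mult.commute)
  finally show ?thesis by simp
qed

lemma smooth_on_imp_Ck_on: "smooth_on S F \<Longrightarrow> Ck_on k S F"
  by (simp add: smooth_on_def)

lemma smooth_on_differentiable: "smooth_on S F \<Longrightarrow> x \<in> S \<Longrightarrow> F differentiable (at x)"
  using smooth_on_imp_Ck_on[of S F "Suc 0"] by simp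

lemma Ck_on_diff_form:
  assumes "open S" "smooth_on S h"
  shows "Ck_on k S (diff_form h)"
  unfolding diff_form_def[abs_def]
  by (intro Ck_on_vec_lambda assms(1) Ck_on_deriv smooth_on_imp_Ck_on assms(2))

text \<open>This is d(L_X h) = L_X(dh). The product rule is applied to the pairing of dh with X;
  symmetry of the Hessian of \<open>h\<close> turns the derivative of dh along \<open>v\<close>,
  paired with X, into its derivative along X, paired with \<open>v\<close>.\<close>

lemma lie_fun_has_derivative:
  assumes "open S" "x \<in> S" "smooth_on S X" "smooth_on S h"
  shows "(lie_fun X h has_derivative (\<lambda>v. lie_form X (diff_form h) x \<bullet> v)) (at x)"
proof -
  let ?\<omega> = "diff_form h"
  note d\<omega> = Ck_on_has_derivative[OF Ck_on_diff_form[OF assms(1,4)] assms(2)]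
  note dX = Ck_on_has_derivative[OF smooth_on_imp_Ck_on[OF assms(3)] assms(2)]
  have "((\<lambda>y. ?\<omega> y \<bullet> X y) has_derivative
      (\<lambda>v. ?\<omega> x \<bullet> frechet_derivative X (at x) v + frechet_derivative ?\<omega> (at x) v \<bullet> X x)) (at x)"
    using d\<omega> dX by (rule has_derivative_inner)
  moreover have "frechet_derivative ?\<omega> (at x) v \<bullet> w = frechet_derivative ?\<omega> (at x) w \<bullet> v" for v w
  proof -
    have "frechet_derivative ?\<omega> (at x) v \<bullet> w =
        frechet_derivative (\<lambda>y. frechet_derivative h (at y) w) (at x) v" for v w
    proof -
      have "((\<lambda>y. ?\<omega> y \<bullet> w) has_derivative (\<lambda>v. frechet_derivative ?\<omega> (at x) v \<bullet> w)) (at x)"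
        by (intro has_derivative_inner_left d\<omega>)
      then have "((\<lambda>y. frechet_derivative h (at y) w) has_derivative (\<lambda>v. frechet_derivative ?\<omega> (at x) v \<bullet> w)) (at x)"
        by (rule has_derivative_transform_within_open[OF _ assms(1,2)])
          (simp add: diff_form_inner smooth_on_differentiable[OF assms(4)])
      then show ?thesis by (metis frechet_derivative_at)
    qed
    then show ?thesis
      using frechet_derivative_symmetric[OF assms(1,2) smooth_on_imp_Ck_on[OF assms(4)]] by simp
  qed
  moreover have "(?\<omega> x v* jacobian X (at x)) \<bullet> v = ?\<omega> x \<bullet> frechet_derivative X (at x) v" for v
    using matrix_vector_mul(2)[OF has_derivative_linear[OF dX]]
    by (simp add: jacobian_def dot_lmul_matrix)
  ultimately have "((\<lambda>y. ?\<omega> y \<bullet> X y) has_derivative (\<lambda>v. lie_form X ?\<omega> x \<bullet> v)) (at x)"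
    by (simp add: lie_form_def inner_add_left add.commute)
  then show ?thesis
    by (rule has_derivative_transform_within_open[OF _ assms(1,2)])
      (simp add: diff_form_inner smooth_on_differentiable[OF assms(4)] lie_fun_def)
qed

text \<open>Evaluating L_X(dH) = \<Xi> dH on a vector \<open>w\<close> of the kernel of dH gives
  zero, and the rows of the left side are the differentials of the functions L_X h_j.\<close>

lemma codist_invariant_lie_fun_derivative:
  fixes h :: "'p::finite \<Rightarrow> real^'n \<Rightarrow> real"
  assumes "open W" "x \<in> W" "smooth_on W X" "\<And>j. smooth_on W (h j)" "codist_invariant W X h"
    and 0: "\<And>j. diff_form (h j) x \<bullet> w = 0"
  shows "frechet_derivative (lie_fun X (h j)) (at x) w = 0"
proof -
  obtain \<Xi> :: "real^'n \<Rightarrow> real^'p^'p" where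
    "(\<chi> j. lie_form X (diff_form (h j)) x) = \<Xi> x ** (\<chi> j. diff_form (h j) x)"
    using assms(2,5) unfolding codist_invariant_def by blast
  then have "lie_form X (diff_form (h j)) x = (\<Xi> x ** (\<chi> j. diff_form (h j) x)) $ j"
    by (metis vec_lambda_beta)
  then have "lie_form X (diff_form (h j)) x \<bullet> w = ((\<Xi> x ** (\<chi> j. diff_form (h j) x)) *v w) $ j"
    by (simp add: matrix_vector_mul_component)
  also have "(\<Xi> x ** (\<chi> j. diff_form (h j) x)) *v w = \<Xi> x *v ((\<chi> j. diff_form (h j) x) *v w)"
    by (simp add: matrix_vector_mul_assoc)
  also have "(\<chi> j. diff_form (h j) x) *v w = 0"
    using 0 by (simp add: vec_eq_iff matrix_vector_mul_component)
  finally have "lie_form X (diff_form (h j)) x \<bullet> w = 0" by simp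
  then show ?thesis
    using frechet_derivative_at[OF lie_fun_has_derivative[OF assms(1-4)]] by metis
qed

section \<open>Linear algebra of projections and complements; constancy along segments\<close>

lemma orthogonal_projection_exists:
  fixes S :: "'a::euclidean_space set"
  assumes "subspace S"
  obtains Q where "linear Q" "\<And>z. Q z \<in> S" "\<And>z s. s \<in> S \<Longrightarrow> s \<bullet> (z - Q z) = 0"
    "\<And>s. s \<in> S \<Longrightarrow> Q s = s" "\<And>z. norm (Q z) \<le> norm z"
proof -
  obtain B where B: "B \<subseteq> S" "pairwise orthogonal B" "\<And>b. b \<in> B \<Longrightarrow> norm b = 1"
    "independent B" "span B = S"
    using orthonormal_basis_subspace[OF assms] by metis
  then have "finite B" using independent_imp_finite by blast
  define Q where "Q z = (\<Sum>b\<in>B. (z \<bullet> b) *\<^sub>R b)" for z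
  have lin: "linear Q"
    unfolding Q_def by (auto intro!: linearI simp: inner_add_left scaleR_add_left sum.distrib scaleR_sum_right)
  have QS: "Q z \<in> S" for z
    unfolding Q_def using B(1) by (intro subspace_sum[OF assms] subspace_scale[OF assms]) auto
  have "b \<bullet> Q z = b \<bullet> z" if "b \<in> B" for b z
  proof -
    have "b \<bullet> Q z = (\<Sum>c\<in>B. (z \<bullet> c) * (b \<bullet> c))"
      by (simp add: Q_def inner_sum_right)
    also have "\<dots> = (\<Sum>c\<in>B. if c = b then z \<bullet> b else 0)"
      using B(2,3) that
      by (intro sum.cong) (auto simp: pairwise_def orthogonal_def norm_eq_1)
    finally show ?thesis using \<open>finite B\<close> that by (simp add: inner_commute)
  qed
  then have orth: "s \<bullet> (z - Q z) = 0" if "s \<in> S" for s z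
    using that orthogonal_to_span[of s B "z - Q z"] B(5)
    by (simp add: orthogonal_def inner_diff_right inner_diff_left inner_commute)
  have fix_S: "Q s = s" if "s \<in> S" for s
    using orth[of "s - Q s" s] subspace_diff[OF assms that QS] by simp
  have "norm (Q z) \<le> norm z" for z
  proof -
    have "(norm z)\<^sup>2 = (norm (Q z))\<^sup>2 + (norm (z - Q z))\<^sup>2"
      using norm_add_Pythagorean[of "Q z" "z - Q z"] orth[OF QS] by (simp add: orthogonal_def)
    then show ?thesis by (simp add: norm_le_square power2_norm_eq_inner[symmetric])
  qed
  with that lin QS orth fix_S show ?thesis by blast
qed

text \<open>The injective map \<open>L\<close> sends the complement of \<open>T\<close> into that of
  \<open>S\<close>. Equal dimensions make this inclusion an equality, so whatever \<open>L\<close>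
  sends into the complement of \<open>S\<close> comes from the complement of \<open>T\<close>.
  Constancy of the rank will enter through \<open>dim S = dim T\<close>.\<close>

lemma inj_linear_orthogonal_vimage:
  fixes L :: "'a::euclidean_space \<Rightarrow> 'a"
  assumes "linear L" "inj L" "subspace S" "subspace T" "dim S = dim T"
    and sub: "\<And>w. \<forall>t\<in>T. t \<bullet> w = 0 \<Longrightarrow> \<forall>s\<in>S. s \<bullet> L w = 0"
    and "\<forall>s\<in>S. s \<bullet> L w = 0" "t \<in> T"
  shows "t \<bullet> w = 0"
proof -
  \<comment> \<open>The orthogonal complement, in the shape of the dimension formula for complements
    within a subspace, here \<open>UNIV\<close>.\<close>
  define C :: "'a set \<Rightarrow> 'a set" where "C A = {y \<in> UNIV. \<forall>x\<in>A. orthogonal x y}" for A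
  have sC: "subspace (C A)" for A
    using subspace_orthogonal_to_vectors[of A] by (simp add: C_def)
  have "dim (C S) = dim (C T)"
    using dim_subspace_orthogonal_to_vectors[OF assms(3) subspace_UNIV subset_UNIV]
      dim_subspace_orthogonal_to_vectors[OF assms(4) subspace_UNIV subset_UNIV] assms(5)
    unfolding C_def by linarith
  moreover have "dim (L ` C T) = dim (C T)"
    using assms(1,2) by (intro dim_image_eq) (auto intro: inj_on_subset)
  moreover have "L ` C T \<subseteq> C S"
    using sub by (auto simp: C_def orthogonal_def)
  ultimately have "L ` C T = C S"
    using subspace_dim_equal[OF linear_subspace_image[OF assms(1) sC] sC] by simp
  moreover have "L w \<in> C S" using assms(7) by (simp add: C_def orthogonal_def)
  ultimately have "w \<in> C T" using assms(2) by (metis inj_image_mem_iff)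
  then show ?thesis using assms(8) by (simp add: C_def orthogonal_def)
qed

lemma eq_if_derivative_zero_along_segment:
  fixes F :: "'a::euclidean_space \<Rightarrow> real"
  assumes "convex B" "p \<in> B" "q \<in> B"
    and "\<And>z. z \<in> B \<Longrightarrow> (F has_derivative F' z) (at z)" "\<And>z. z \<in> B \<Longrightarrow> F' z (q - p) = 0"
  shows "F p = F q"
proof -
  let ?c = "\<lambda>t. p + t *\<^sub>R (q - p)"
  have c: "?c t \<in> B" if "t \<in> {0..1}" for t
    using convexD_alt[OF assms(1-3), of t] that by (simp add: algebra_simps)
  have "((\<lambda>t. F (?c t)) has_derivative (\<lambda>t. 0)) (at t within {0..1})" if "t \<in> {0..1}" for t
  proof -
    note d = assms(4)[OF c[OF that]]
    have "(?c has_derivative (\<lambda>s. s *\<^sub>R (q - p))) (at t within {0..1})"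
      by (auto intro!: derivative_eq_intros)
    from has_derivative_compose[OF this d] show ?thesis
      by (simp add: linear_cmul[OF has_derivative_linear[OF d]] assms(5)[OF c[OF that]])
  qed
  from has_derivative_zero_unique[OF _ this, of 0 1] show ?thesis by simp
qed

theorem mainTheorem7:
  fixes W :: "(real^'n) set"
    and f :: "real^'n \<Rightarrow> real^'n"
    and m :: nat
    and g :: "nat \<Rightarrow> real^'n \<Rightarrow> real^'n"
    and h :: "'p::finite \<Rightarrow> real^'n \<Rightarrow> real"
  assumes "open W" and "0 \<in> W"
    and "smooth_on W f"
    and "\<And>i. i \<in> {1..m} \<Longrightarrow> smooth_on W (g i)"
    and "\<And>j. smooth_on W (h j)"
    and "\<And>j. h j 0 = 0"
    and "regular_point (exact_codist h) 0"
    and "codist_invariant W f h"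
    and "\<And>i. i \<in> {1..m} \<Longrightarrow> codist_invariant W (g i) h"
  shows "\<exists>V \<psi>. exact_or_system W f m g h V \<psi>"
proof -

  \<comment> \<open>The span at 0, its projection and a neighbourhood of constant rank\<close>
  let ?dh = "\<lambda>j. diff_form (h j)"
  define S where "S = exact_codist h 0"
  have sub: "subspace (exact_codist h x)" for x by (simp add: exact_codist_def)
  have dhS: "?dh j x \<in> exact_codist h x" for j x by (auto simp: exact_codist_def intro: span_base)
  have dh0: "?dh j 0 \<in> S" for j using dhS by (simp add: S_def)
  have "subspace S" using sub by (simp add: S_def)
  then obtain Q where Q: "linear Q" "\<And>z. Q z \<in> S" "\<And>z s. s \<in> S \<Longrightarrow> s \<bullet> (z - Q z) = 0"
    "\<And>s. s \<in> S \<Longrightarrow> Q s = s" "\<And>z. norm (Q z) \<le> norm z"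
    using orthogonal_projection_exists by metis
  have blQ: "bounded_linear Q" using Q(1) linear_conv_bounded_linear by blast
  define A where "A y = (\<Sum>j\<in>UNIV. y $ j *\<^sub>R ?dh j 0)" for y :: "real^'p"
  have blA: "bounded_linear A"
    unfolding A_def by (intro bounded_linear_sum bounded_linear_scaleR_const bounded_linear_vec_nth)
  have AS: "A y \<in> S" for y
    unfolding A_def by (intro subspace_sum subspace_scale dh0 \<open>subspace S\<close>)

  obtain U0 where U0: "open U0" "0 \<in> U0" "U0 \<subseteq> W"
    and rank: "\<And>x. x \<in> U0 \<Longrightarrow> dim S = dim (exact_codist h x)"
  proof -
    obtain r where "\<forall>\<^sub>F x in nhds 0. dim (exact_codist h x) = r"
      using assms(7) unfolding regular_point_def by blast
    then obtain N where "open N" "0 \<in> N" "\<And>x. x \<in> N \<Longrightarrow> dim (exact_codist h x) = r"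
      unfolding eventually_nhds by blast
    then show thesis
      using assms(1,2) that[of "N \<inter> W"] by (simp add: S_def open_Int)
  qed

  \<comment> \<open>The map \<open>\<Phi>\<close>, its derivative and its local inverse
    \<open>\<Psi>\<close>\<close>
  define \<Phi> where "\<Phi> x = A (output_map h x) + (x - Q x)" for x
  define d\<Phi> where "d\<Phi> x w = A (\<chi> j. ?dh j x \<bullet> w) + (w - Q w)" for x w
  have smooth\<Phi>: "Ck_on k W \<Phi>" for k
  proof -
    have "bounded_linear (\<lambda>x. x - Q x)" by (intro bounded_linear_sub bounded_linear_ident blQ)
    then show ?thesis
      unfolding \<Phi>_def output_map_def
      by (intro Ck_on_add Ck_on_bounded_linear[OF _ blA] Ck_on_vec_lambda smooth_on_imp_Ck_on assms(1,5)
        Ck_on_bounded_linear[where F = "\<lambda>x. x" and L = "\<lambda>x. x - Q x"] Ck_on_ident)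
  qed
  have der\<Phi>: "(\<Phi> has_derivative d\<Phi> x) (at x)" if "x \<in> W" for x
  proof -
    have "(h j has_derivative (\<lambda>w. ?dh j x \<bullet> w)) (at x)" for j
      using smooth_on_differentiable[OF assms(5) that]
      by (simp add: diff_form_inner frechet_derivative_works[symmetric])
    then have "(output_map h has_derivative (\<lambda>w. \<chi> j. ?dh j x \<bullet> w)) (at x)"
      unfolding output_map_def[abs_def] vec_lambda_eq_sum_axis
      by (intro has_derivative_sum has_derivative_scaleR_left)
    then show ?thesis
      unfolding \<Phi>_def[abs_def] d\<Phi>_def[abs_def]
      by (intro has_derivative_add has_derivative_diff has_derivative_ident
          bounded_linear.has_derivative[OF blA] bounded_linear.has_derivative[OF blQ])
  qed
  then have bl: "bounded_linear (d\<Phi> x)" if "x \<in> W" for x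
    using that has_derivative_bounded_linear by blast
  \<comment> \<open>Pairing \<open>d\<Phi> 0 w = 0\<close> with \<open>w\<close> gives a sum of
    squares plus the squared norm of \<open>w - Q w\<close>. Both vanish, so \<open>w\<close> lies
    in \<open>S\<close> and is orthogonal to the generators of \<open>S\<close>, hence to
    itself.\<close>
  have inj0: "inj (d\<Phi> 0)"
  proof (subst linear_injective_0[OF bounded_linear.linear[OF bl[OF assms(2)]]], intro allI impI)
    fix w assume w: "d\<Phi> 0 w = 0"
    have "w \<bullet> A (\<chi> j. ?dh j 0 \<bullet> w) = (\<Sum>j\<in>UNIV. (?dh j 0 \<bullet> w)\<^sup>2)"
      by (simp add: A_def inner_sum_right power2_eq_square inner_commute)
    moreover have "w \<bullet> (w - Q w) = (w - Q w) \<bullet> (w - Q w)"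
      using Q(3)[OF Q(2)] by (simp add: inner_diff_left)
    ultimately have "(\<Sum>j\<in>UNIV. (?dh j 0 \<bullet> w)\<^sup>2) + (w - Q w) \<bullet> (w - Q w) = 0"
      using w by (metis d\<Phi>_def inner_add_right inner_zero_right)
    moreover have "0 \<le> (\<Sum>j\<in>UNIV. (?dh j 0 \<bullet> w)\<^sup>2)" by (simp add: sum_nonneg)
    ultimately have "(\<Sum>j\<in>UNIV. (?dh j 0 \<bullet> w)\<^sup>2) = 0" and "w = Q w"
      using inner_ge_zero[of "w - Q w"] by (auto simp: add_nonneg_eq_0_iff)
    then have "\<forall>j. orthogonal w (?dh j 0)" and "w \<in> S"
      using Q(2)[of w] by (auto simp: sum_nonneg_eq_0_iff orthogonal_def inner_commute)
    then have "orthogonal w w"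
      using orthogonal_to_span[of w "range (\<lambda>j. ?dh j 0)" w] by (auto simp: S_def exact_codist_def)
    then show "w = 0" by (simp add: orthogonal_self)
  qed
  then obtain L where "linear L" "L \<circ> d\<Phi> 0 = id"
    using linear_injective_left_inverse bounded_linear.linear[OF bl[OF assms(2)]] by blast
  then have inv0: "Blinfun L o\<^sub>L Blinfun (d\<Phi> 0) = id_blinfun"
    using bl[OF assms(2)]
    by (intro blinfun_eqI) (simp add: bounded_linear_Blinfun_apply linear_conv_bounded_linear pointfree_idE)
  \<comment> \<open>The inverse function theorem asks for continuity in operator norm; in finite
    dimension, continuity on each basis vector suffices.\<close>
  have cont: "continuous_on U0 (\<lambda>x. Blinfun (d\<Phi> x))"
  proof (rule continuous_on_blinfun_componentwise)
    fix b :: "real^'n"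
    have "continuous_on W (?dh j)" for j
      using Ck_on_diff_form[OF assms(1,5), of 0] by simp
    then have "continuous_on U0 (\<lambda>x. d\<Phi> x b)"
      unfolding d\<Phi>_def using U0(3)
      by (intro continuous_intros bounded_linear.continuous_on[OF blA]) (auto intro: continuous_on_subset)
    then show "continuous_on U0 (\<lambda>x. blinfun_apply (Blinfun (d\<Phi> x)) b)"
      using bl U0(3) by (auto simp: bounded_linear_Blinfun_apply subset_eq cong: continuous_on_cong)
  qed
  have derB: "(\<Phi> has_derivative blinfun_apply (Blinfun (d\<Phi> x))) (at x)" if "x \<in> U0" for x
    using der\<Phi>[of x] bl[of x] that U0(3) by (auto simp: bounded_linear_Blinfun_apply)
  obtain U' V \<Psi> \<Psi>' where U': "open U'" "U' \<subseteq> U0" "0 \<in> U'" and V: "open V" "\<Phi> 0 \<in> V"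
    and hom: "homeomorphism U' V \<Phi> \<Psi>"
    and d\<Psi>: "\<And>y. y \<in> V \<Longrightarrow> (\<Psi> has_derivative \<Psi>' y) (at y)"
    and \<Psi>': "\<And>y. y \<in> V \<Longrightarrow> \<Psi>' y = inv (blinfun_apply (Blinfun (d\<Phi> (\<Psi> y))))"
    and bij: "\<And>y. y \<in> V \<Longrightarrow> bij (blinfun_apply (Blinfun (d\<Phi> (\<Psi> y))))"
    using inverse_function_theorem[OF U0(1) derB cont U0(2) inv0] by metis
  have \<Psi>U: "\<Psi> y \<in> U'" "\<Psi> y \<in> U0" "\<Psi> y \<in> W" if "y \<in> V" for y
    using hom that U'(2) U0(3) by (auto simp: homeomorphism_def)
  have bij': "bij (d\<Phi> (\<Psi> y))" and d\<Phi>\<Psi>': "d\<Phi> (\<Psi> y) (\<Psi>' y v) = v" if "y \<in> V" for y v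
    using bij[OF that] \<Psi>'[OF that] bl[OF \<Psi>U(3)[OF that]]
    by (auto simp: bounded_linear_Blinfun_apply bij_is_surj surj_f_inv_f)

  have "output_map h 0 = 0" by (simp add: output_map_def vec_eq_iff assms(6))
  then have \<Phi>0: "\<Phi> 0 = 0"
    by (simp add: \<Phi>_def linear_0[OF Q(1)] linear_0[OF bounded_linear.linear[OF blA]])
  \<comment> \<open>A ball is convex and mapped into itself by the norm-decreasing \<open>Q\<close>,
    so it contains the segment from \<open>Q z\<close> to \<open>z\<close> with each of its points
    \<open>z\<close>.\<close>
  then obtain e where "0 < e" and e: "ball 0 e \<subseteq> V" using V openE by metis
  let ?B = "ball (0::real^'n) e"
  have smooth\<Psi>: "Ck_on k ?B \<Psi>" for k
  proof -
    have "smooth_on ?B \<Psi>"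
    proof (rule smooth_on_inverse[OF U'(1) open_ball])
      show "\<Psi> ` ?B \<subseteq> U'" using e \<Psi>U(1) by blast
      show "smooth_on U' \<Phi>"
        unfolding smooth_on_def using Ck_on_subset[OF smooth\<Phi>] U'(2) U0(3) by blast
      show "(\<Psi> has_derivative \<Psi>' y) (at y)" if "y \<in> ?B" for y using d\<Psi> that e by blast
      show "frechet_derivative \<Phi> (at (\<Psi> y)) (\<Psi>' y v) = v" if "y \<in> ?B" for y v
        using d\<Phi>\<Psi>' frechet_derivative_at[OF der\<Phi>[OF \<Psi>U(3)]] that e by (metis subsetD)
    qed
    then show ?thesis by (rule smooth_on_imp_Ck_on)
  qed

  \<comment> \<open>Constancy of the Lie derivatives of the outputs along the fibres\<close>
  have ker: "?dh j (\<Psi> z) \<bullet> \<Psi>' z v = 0" if "z \<in> V" "\<forall>s\<in>S. s \<bullet> v = 0" for j z v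
  proof (rule inj_linear_orthogonal_vimage[where L = "d\<Phi> (\<Psi> z)" and S = S and T = "exact_codist h (\<Psi> z)"])
    \<comment> \<open>On the kernel of dH the first summand of \<open>d\<Phi>\<close> vanishes,
      leaving \<open>w - Q w\<close>, which is orthogonal to \<open>S\<close>.\<close>
    show "\<forall>s\<in>S. s \<bullet> d\<Phi> (\<Psi> z) w = 0" if "\<forall>t\<in>exact_codist h (\<Psi> z). t \<bullet> w = 0" for w
    proof -
      have "(\<chi> j. ?dh j (\<Psi> z) \<bullet> w) = 0" using that dhS by (simp add: vec_eq_iff)
      then show ?thesis
        using Q(3) by (simp add: d\<Phi>_def linear_0[OF bounded_linear.linear[OF blA]])
    qed
  qed (use that dhS sub \<open>subspace S\<close> rank \<Psi>U bl bij' d\<Phi>\<Psi>' in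
      \<open>auto simp: bounded_linear.linear bij_is_inj\<close>)
  \<comment> \<open>The direction \<open>z - Q z\<close> is orthogonal to \<open>S\<close>, so
    \<open>\<Psi>'\<close> carries it into the kernel of dH at every point of the segment; there
    invariance annihilates the derivative of L_X h_j.\<close>
  have const: "lie_fun X (h j) (\<Psi> (Q z)) = lie_fun X (h j) (\<Psi> z)"
    if X: "smooth_on W X" "codist_invariant W X h" and z: "z \<in> ?B" for X j z
  proof (rule eq_if_derivative_zero_along_segment[OF convex_ball _ z])
    show "Q z \<in> ?B" using Q(5)[of z] z by simp
    fix y assume "y \<in> ?B"
    then have y: "y \<in> V" using e by blast
    have "(lie_fun X (h j) has_derivative frechet_derivative (lie_fun X (h j)) (at (\<Psi> y))) (at (\<Psi> y))"
      using lie_fun_has_derivative[OF assms(1) \<Psi>U(3)[OF y] X(1) assms(5)]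
      by (metis differentiableI frechet_derivative_works)
    from has_derivative_compose[OF d\<Psi>[OF y] this]
    show "((\<lambda>y. lie_fun X (h j) (\<Psi> y)) has_derivative
        (\<lambda>v. frechet_derivative (lie_fun X (h j)) (at (\<Psi> y)) (\<Psi>' y v))) (at y)" .
    show "frechet_derivative (lie_fun X (h j)) (at (\<Psi> y)) (\<Psi>' y (z - Q z)) = 0"
      using codist_invariant_lie_fun_derivative[OF assms(1) \<Psi>U(3)[OF y] X(1) assms(5) X(2)]
        ker[OF y] Q(3) by blast
  qed

  \<comment> \<open>The map \<open>\<psi>\<close> and exactness of its OR-system\<close>
  define V' where "V' = A -` ?B"
  define \<psi> where "\<psi> y = \<Psi> (A y)" for y
  have "open V'"
    unfolding V'_def by (intro open_vimage open_ball linear_continuous_on blA)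
  \<comment> \<open>\<open>Q\<close> fixes the range of \<open>A\<close>, which lies in
    \<open>S\<close>, and kills \<open>x - Q x\<close>. Thus \<open>\<psi>\<close> at the output of
    \<open>x\<close> is \<open>\<Psi> (Q (\<Phi> x))\<close>.\<close>
  have Q\<Phi>: "A (output_map h x) = Q (\<Phi> x)" for x
    using Q(4)[OF AS] Q(4)[OF Q(2)] by (simp add: \<Phi>_def linear_add[OF Q(1)] linear_diff[OF Q(1)])
  define U where "U = U' \<inter> \<Phi> -` ?B"
  \<comment> \<open>Take \<open>z = \<Phi> x\<close> in \<open>const\<close>; on \<open>U\<close>
    this point lies in the ball and \<open>\<Psi> (\<Phi> x) = x\<close>.\<close>
  have exact: "or_field X h \<psi> (output_map h x) = lie_output X h x"
    if "smooth_on W X" "codist_invariant W X h" "x \<in> U" for X x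
    using const[OF that(1,2), of "\<Phi> x"] that(3) hom
    by (simp add: or_field_def lie_output_def \<psi>_def Q\<Phi> U_def homeomorphism_def)
  have "open U"
    unfolding U_def using hom U'(1) by (intro continuous_open_preimage open_ball) (auto simp: homeomorphism_def)
  moreover have "0 \<in> U" using U'(3) \<Phi>0 \<open>0 < e\<close> by (simp add: U_def)
  moreover have "U \<subseteq> W" using U'(2) U0(3) by (auto simp: U_def)
  moreover have "output_map h ` U \<subseteq> V'"
    by (auto simp: U_def V'_def Q\<Phi> intro: le_less_trans[OF Q(5)])
  moreover have "smooth_on V' \<psi>"
    unfolding smooth_on_def \<psi>_def
  proof
    fix k
    show "Ck_on k V' (\<lambda>y. \<Psi> (A y))"
      by (rule Ck_on_compose[OF \<open>open V'\<close> open_ball _ smooth\<Psi>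
            Ck_on_bounded_linear[OF \<open>open V'\<close> blA Ck_on_ident[OF \<open>open V'\<close>]]]) (auto simp: V'_def)
  qed
  moreover have "\<psi> ` V' \<subseteq> W"
    using \<Psi>U(3) e by (auto simp: \<psi>_def V'_def)
  moreover have "0 \<in> V'"
    using \<open>0 < e\<close> by (simp add: V'_def linear_0[OF bounded_linear.linear[OF blA]])
  ultimately have "exact_or_system W f m g h V' \<psi>"
    unfolding exact_or_system_def
    using \<open>open V'\<close> exact[OF assms(3,8)] exact[OF assms(4,9)]
    by (intro conjI exI[of _ U] ballI) simp_all
  then show ?thesis by blast
qed

end
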